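(* Let $D\subset\mathbb{C}^n$ be a bounded circular domain with $0\in D$. Then the Friedrichs operator of $D$ is of rank one.
   Context: A domain $D\subset\mathbb{C}^n$ is circular if $e^{i\theta}z\in D$ for every $z\in D$ and $\theta\in\mathbb{R}$. For a domain $D\subset\mathbb{C}^n$, the Bergman space $A^2(D)$ is the closed subspace of $L^2(D)$ (with respect to Lebesgue measure, with inner product $\langle f,g\rangle=\int_D f\bar g\,dV$) consisting of holomorphic functions. The Bergman projection $B_D$ is the orthogonal projection of $L^2(D)$ onto $A^2(D)$. The Friedrichs operator of $D$ is the (conjugate-linear) map $F_D\colon A^2(D)\to A^2(D)$, $F_D(g)=B_D(\bar g)$. It is of rank one if its range is a one-dimensional complex vector space. *)

theory Defs
  imports "HOL-Analysis.Analysis" "HOL-Library.Function_Algebras"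
begin

definition domain_Cn :: "(complex ^ 'n) set \<Rightarrow> bool" where
  "domain_Cn D \<longleftrightarrow> open D \<and> connected D \<and> D \<noteq> {}"

definition circular :: "(complex ^ 'n) set \<Rightarrow> bool" where
  "circular D \<longleftrightarrow> (\<forall>z\<in>D. \<forall>\<theta>::real. exp (\<i> * of_real \<theta>) *s z \<in> D)"

text \<open>Holomorphy in several variables: real Frechet differentiability at each point of the
  (open) set, with a derivative that is homogeneous over the complex numbers.\<close>

definition holomorphic_Cn :: "(complex ^ 'n \<Rightarrow> complex) \<Rightarrow> (complex ^ 'n) set \<Rightarrow> bool" where
  "holomorphic_Cn f D \<longleftrightarrow>
     (\<forall>z\<in>D. \<exists>f'. (f has_derivative f') (at z) \<and> (\<forall>c v. f' (c *s v) = c * f' v))"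

text \<open>Square-integrable functions, not identified modulo null sets.\<close>

definition L2_on :: "(complex ^ 'n) set \<Rightarrow> (complex ^ 'n \<Rightarrow> complex) set" where
  "L2_on D = {f \<in> borel_measurable (lebesgue_on D).
                integrable (lebesgue_on D) (\<lambda>z. (cmod (f z))\<^sup>2)}"

definition L2_inner ::
    "(complex ^ 'n) set \<Rightarrow> (complex ^ 'n \<Rightarrow> complex) \<Rightarrow> (complex ^ 'n \<Rightarrow> complex) \<Rightarrow> complex" where
  "L2_inner D f g = integral\<^sup>L (lebesgue_on D) (\<lambda>z. f z * cnj (g z))"

text \<open>Functions on \<open>D\<close> are represented by total functions vanishing outside \<open>D\<close>, so that equality
  of functions on \<open>D\<close> is equality in HOL. For open \<open>D\<close>, each class of \<open>L\<^sup>2(D)\<close> contains at most one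
  element of this set, since holomorphic functions agreeing almost everywhere agree.\<close>

definition bergman_space :: "(complex ^ 'n) set \<Rightarrow> (complex ^ 'n \<Rightarrow> complex) set" where
  "bergman_space D = {f \<in> L2_on D. holomorphic_Cn f D \<and> (\<forall>z. z \<notin> D \<longrightarrow> f z = 0)}"

text \<open>Orthogonal projection: the element \<open>g\<close> of the Bergman space with \<open>f - g\<close> orthogonal to
  that space. For \<open>D\<close> open and \<open>f \<in> L2_on D\<close> such \<open>g\<close> exists uniquely, because the Bergman space
  is a closed subspace of \<open>L\<^sup>2(D)\<close>.\<close>

definition bergman_projection ::
    "(complex ^ 'n) set \<Rightarrow> (complex ^ 'n \<Rightarrow> complex) \<Rightarrow> (complex ^ 'n \<Rightarrow> complex)" where
  "bergman_projection D f =
     (THE g. g \<in> bergman_space D \<and> (\<forall>h\<in>bergman_space D. L2_inner D (\<lambda>z. f z - g z) h = 0))"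

definition friedrichs_operator ::
    "(complex ^ 'n) set \<Rightarrow> (complex ^ 'n \<Rightarrow> complex) \<Rightarrow> (complex ^ 'n \<Rightarrow> complex)" where
  "friedrichs_operator D g = bergman_projection D (\<lambda>z. cnj (g z))"

definition fun_scale :: "complex \<Rightarrow> ('a \<Rightarrow> complex) \<Rightarrow> ('a \<Rightarrow> complex)" where
  "fun_scale c f = (\<lambda>z. c * f z)"

global_interpretation cfun: vector_space "fun_scale :: complex \<Rightarrow> ('a \<Rightarrow> complex) \<Rightarrow> ('a \<Rightarrow> complex)"
  by unfold_locales (auto simp: fun_scale_def fun_eq_iff algebra_simps)

text \<open>The library's \<open>dim\<close> of a set is the dimension of its span, so being a subspace is
  required separately; \<open>dim\<close> is 0 (not 1) for infinite-dimensional spaces.\<close>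

definition rank_one_on ::
    "('a \<Rightarrow> complex) set \<Rightarrow> (('a \<Rightarrow> complex) \<Rightarrow> ('a \<Rightarrow> complex)) \<Rightarrow> bool" where
  "rank_one_on V T \<longleftrightarrow> cfun.subspace (T ` V) \<and> cfun.dim (T ` V) = 1"

end

theory Submission
  imports Defs "HOL-Complex_Analysis.Complex_Analysis"
begin

text \<open>
  The Friedrichs operator is conjugated evaluation at the centre: for \<open>g\<close> in the Bergman space,
  \<open>F g = cnj (g 0)\<close> times the constant function \<open>1\<close> on \<open>D\<close>. Its range is therefore the line
  spanned by that constant, which is square integrable because \<open>D\<close> is bounded.

  Orthogonality of \<open>cnj g - cnj (g 0)\<close> to every \<open>h\<close> in the Bergman space means, after
  conjugation, that \<open>g h\<close> and \<open>g(0) h\<close> have the same integral over \<open>D\<close>. Both are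
  holomorphic and integrable, with the same value at \<open>0\<close>, so it suffices that every
  integrable holomorphic function \<open>f\<close> on \<open>D\<close> satisfies the mean value property
  \<open>\<integral>f = f(0) vol(D)\<close> (\<open>mean_value_circular_domain\<close>).

  Since \<open>D\<close> and Lebesgue measure are invariant under \<open>z \<mapsto> e\<^sup>i\<^sup>t z\<close>, the integral of \<open>f\<close> does not
  change when \<open>f\<close> is replaced by its average over the circles \<open>{e\<^sup>i\<^sup>t z}\<close>. This average is the
  constant \<open>f(0)\<close> (\<open>circle_mean_eq_centre\<close>). For \<open>z\<close> in a ball around \<open>0\<close> inside \<open>D\<close> that is
  Cauchy's formula on the disc spanned by \<open>z\<close>. For other \<open>z\<close> the disc need not lie in \<open>D\<close>;
  but the average is holomorphic in \<open>z\<close> and \<open>D\<close> is connected, so the identity theorem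
  carries the equality from the ball to all of \<open>D\<close>. The identity theorem is applied on
  complex lines, which reduces that last step to one complex variable.
\<close>

section \<open>Invariance of Lebesgue measure under orthogonal maps\<close>

text \<open>Uniqueness of Haar measure, in the normalised form that identifies Lebesgue measure. With
  \<open>B\<close> the unit ball, the double integral of \<open>1\<^sub>A(x) 1\<^sub>B(y - x)\<close> against \<open>M\<close> in \<open>x\<close> and Lebesgue
  measure in \<open>y\<close> is computed in both orders. Integrating over \<open>y\<close> first gives the product of
  the \<open>M\<close>-measure of \<open>A\<close> and the volume of \<open>B\<close>. Translating \<open>x\<close> by \<open>y\<close> first and then
  integrating over \<open>y\<close> gives the volume of \<open>A\<close> times the \<open>M\<close>-measure of \<open>-B = B\<close>.\<close>

lemma translation_invariant_eq_lborel:
  fixes M :: "'a::euclidean_space measure"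
  assumes sets_M [measurable_cong]: "sets M = sets borel"
    and "sigma_finite_measure M"
    and inv: "\<And>a. distr M borel ((+) a) = M"
    and ball: "emeasure M (ball 0 1) = emeasure lborel (ball 0 1 :: 'a set)"
  shows "M = lborel"
proof (rule measure_eqI)
  interpret M: sigma_finite_measure M by fact
  interpret pair_sigma_finite M "lborel :: 'a measure" ..
  have invL: "distr lborel borel ((+) a) = (lborel :: 'a measure)" for a
    by (rule lborel_distr_plus)
  fix A assume "A \<in> sets M"
  then have A [measurable]: "A \<in> sets borel" by (simp add: sets_M)
  define B :: "'a set" where "B = ball 0 1"
  have B [measurable]: "B \<in> sets borel" by (simp add: B_def)
  have uB: "- x \<in> B \<longleftrightarrow> x \<in> B" for x by (simp add: B_def dist_norm)
  have "emeasure M A * emeasure lborel B = (\<integral>\<^sup>+x. indicator A x * emeasure lborel B \<partial>M)"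
    by (simp add: nn_integral_multc sets_M)
  also have "\<dots> = (\<integral>\<^sup>+x. indicator A x * (\<integral>\<^sup>+y. indicator B y \<partial>lborel) \<partial>M)"
    by simp
  also have "\<dots> = (\<integral>\<^sup>+x. (\<integral>\<^sup>+y. indicator A x * indicator B (y - x) \<partial>lborel) \<partial>M)"
  proof (rule nn_integral_cong)
    fix x :: 'a
    have "(\<integral>\<^sup>+y. indicator B (y - x) \<partial>lborel) = (\<integral>\<^sup>+y. indicator B (y - x) \<partial>distr lborel borel ((+) x))"
      unfolding invL ..
    also have "\<dots> = (\<integral>\<^sup>+y. indicator B y \<partial>lborel)"
      by (subst nn_integral_distr) auto
    finally show "indicator A x * (\<integral>\<^sup>+y. indicator B y \<partial>lborel)
        = (\<integral>\<^sup>+y. indicator A x * indicator B (y - x) \<partial>lborel)"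
      by (simp add: nn_integral_cmult)
  qed
  also have "\<dots> = (\<integral>\<^sup>+y. (\<integral>\<^sup>+x. indicator A x * indicator B (y - x) \<partial>M) \<partial>lborel)"
    by (rule Fubini'[symmetric]) measurable
  also have "\<dots> = (\<integral>\<^sup>+y. (\<integral>\<^sup>+x. indicator A (x + y) * indicator B (- x) \<partial>M) \<partial>lborel)"
  proof (rule nn_integral_cong)
    fix y :: 'a
    have "(\<integral>\<^sup>+x. indicator A x * indicator B (y - x) \<partial>M)
       = (\<integral>\<^sup>+x. indicator A x * indicator B (y - x) \<partial>distr M borel ((+) y))"
      unfolding inv ..
    also have "\<dots> = (\<integral>\<^sup>+x. indicator A (x + y) * indicator B (- x) \<partial>M)"
      by (subst nn_integral_distr) (auto simp: add.commute)
    finally show "(\<integral>\<^sup>+x. indicator A x * indicator B (y - x) \<partial>M)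
       = (\<integral>\<^sup>+x. indicator A (x + y) * indicator B (- x) \<partial>M)" .
  qed
  also have "\<dots> = (\<integral>\<^sup>+y. (\<integral>\<^sup>+x. indicator A (x + y) * indicator B x \<partial>M) \<partial>lborel)"
    by (simp add: uB indicator_def)
  also have "\<dots> = (\<integral>\<^sup>+x. (\<integral>\<^sup>+y. indicator A (x + y) * indicator B x \<partial>lborel) \<partial>M)"
    by (rule Fubini') measurable
  also have "\<dots> = (\<integral>\<^sup>+x. (\<integral>\<^sup>+y. indicator A y \<partial>lborel) * indicator B x \<partial>M)"
  proof (rule nn_integral_cong)
    fix x :: 'a
    have "(\<integral>\<^sup>+y. indicator A y \<partial>lborel) = (\<integral>\<^sup>+y. indicator A y \<partial>distr lborel borel ((+) x))"
      unfolding invL ..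
    also have "\<dots> = (\<integral>\<^sup>+y. indicator A (x + y) \<partial>lborel)"
      by (subst nn_integral_distr) auto
    finally show "(\<integral>\<^sup>+y. indicator A (x + y) * indicator B x \<partial>lborel)
      = (\<integral>\<^sup>+y. indicator A y \<partial>lborel) * indicator B x"
      by (simp add: nn_integral_multc)
  qed
  also have "\<dots> = emeasure lborel A * emeasure M B"
    by (simp add: nn_integral_cmult sets_M)
  finally have eq: "emeasure M A * emeasure lborel B = emeasure lborel A * emeasure lborel B"
    using ball by (simp add: B_def)
  have "emeasure lborel B \<noteq> 0"
    using content_ball_pos[of 1 "0 :: 'a"] by (auto simp: B_def measure_def)
  moreover have "emeasure lborel B \<noteq> \<infinity>"
    using emeasure_lborel_ball_finite[of "0 :: 'a" 1] by (auto simp: B_def)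
  moreover have "emeasure lborel B * emeasure M A = emeasure lborel B * emeasure lborel A"
    using eq by (simp only: mult.commute)
  ultimately show "emeasure M A = emeasure lborel A"
    by (simp add: ennreal_mult_cancel_left)
qed (simp add: sets_M)

text \<open>A surjective linear map transports translation invariance, since the translation by
  \<open>f b\<close> after \<open>f\<close> is \<open>f\<close> after the translation by \<open>b\<close>; an isometry also preserves the balls
  around \<open>0\<close>, which supplies both the normalisation and sigma-finiteness.\<close>

lemma distr_lborel_orthogonal_transformation:
  fixes f :: "'a::euclidean_space \<Rightarrow> 'a"
  assumes f: "orthogonal_transformation f"
  shows "distr lborel borel f = lborel"
proof (rule translation_invariant_eq_lborel)
  have lin: "linear f" and nrm: "\<And>x. norm (f x) = norm x"
    using f by (auto simp: orthogonal_transformation)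
  have f_meas [measurable]: "f \<in> borel_measurable borel"
    using lin by (intro borel_measurable_continuous_onI linear_continuous_on)
      (simp add: linear_conv_bounded_linear)
  have ball: "emeasure (distr lborel borel f) (ball 0 r) = emeasure lborel (ball 0 r :: 'a set)" for r
    by (subst emeasure_distr) (auto intro!: arg_cong[where f = "emeasure lborel"] simp: nrm)
  show "emeasure (distr lborel borel f) (ball 0 1) = emeasure lborel (ball 0 1 :: 'a set)"
    by (rule ball)
  show "sigma_finite_measure (distr lborel borel f)"
  proof
    show "\<exists>A. countable A \<and> A \<subseteq> sets (distr lborel borel f) \<and> \<Union>A = space (distr lborel borel f) \<and>
      (\<forall>a\<in>A. emeasure (distr lborel borel f) a \<noteq> \<infinity>)"
    proof (intro exI conjI ballI)
      show "\<Union>(range (\<lambda>n::nat. ball (0::'a) (real n))) = space (distr lborel borel f)"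
        by (auto intro: reals_Archimedean2)
      fix X assume "X \<in> range (\<lambda>n::nat. ball (0::'a) (real n))"
      then obtain n :: nat where "X = ball 0 n" by blast
      then show "emeasure (distr lborel borel f) X \<noteq> \<infinity>"
        using emeasure_lborel_ball_finite[of "0 :: 'a" n] by (simp add: ball)
    qed auto
  qed
  fix a :: 'a
  obtain b where b: "f b = a"
    using orthogonal_transformation_surj[OF f] by (metis surjD)
  have "distr (distr lborel borel f) borel ((+) a) = distr lborel borel ((+) a \<circ> f)"
    by (subst distr_distr) auto
  also have "(+) a \<circ> f = f \<circ> (+) b"
    by (auto simp: b[symmetric] linear_add[OF lin])
  also have "distr lborel borel (f \<circ> (+) b) = distr (distr lborel borel ((+) b)) borel f"
    by (subst distr_distr) auto
  finally show "distr (distr lborel borel f) borel ((+) a) = distr lborel borel f"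
    by (simp add: lborel_distr_plus)
qed simp

section \<open>Holomorphic functions on complex lines\<close>

lemma holomorphic_Cn_continuous_on: "holomorphic_Cn f D \<Longrightarrow> continuous_on D f"
  by (meson continuous_at_imp_continuous_on has_derivative_continuous holomorphic_Cn_def)

lemma continuous_on_vector_scale [continuous_intros]:
  fixes g :: "'b::topological_space \<Rightarrow> complex ^ 'n"
  assumes "continuous_on S c" "continuous_on S g"
  shows "continuous_on S (\<lambda>x. c x *s g x)"
  unfolding vector_scalar_mult_def by (intro continuous_intros assms)

lemma holomorphic_Cn_along_line:
  assumes "holomorphic_Cn f D" and "\<And>\<zeta>. \<zeta> \<in> S \<Longrightarrow> a + \<zeta> *s b \<in> D"
  shows "(\<lambda>\<zeta>. f (a + \<zeta> *s b)) holomorphic_on S"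
proof -
  have "(\<lambda>\<zeta>. f (a + \<zeta> *s b)) field_differentiable at \<zeta> within S" if "\<zeta> \<in> S" for \<zeta>
  proof -
    have "a + \<zeta> *s b \<in> D" by (rule assms(2)[OF that])
    then obtain f' where f': "(f has_derivative f') (at (a + \<zeta> *s b))"
      and hom: "\<And>c v. f' (c *s v) = c * f' v"
      using assms(1) unfolding holomorphic_Cn_def by meson
    have "linear (\<lambda>\<zeta>. \<zeta> *s b)"
      by (rule linearI) (auto simp: vec_eq_iff algebra_simps)
    then have "((\<lambda>\<zeta>. a + \<zeta> *s b) has_derivative (\<lambda>h. h *s b)) (at \<zeta>)"
      using bounded_linear_imp_has_derivative[of "\<lambda>\<zeta>. \<zeta> *s b"]
      by (auto intro!: derivative_eq_intros simp: linear_conv_bounded_linear)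
    then have "((\<lambda>\<zeta>. f (a + \<zeta> *s b)) has_derivative (\<lambda>h. f' (h *s b))) (at \<zeta>)"
      by (rule has_derivative_compose) (use f' in simp)
    then have "((\<lambda>\<zeta>. f (a + \<zeta> *s b)) has_field_derivative f' b) (at \<zeta>)"
      by (simp add: has_field_derivative_def hom mult.commute[of _ "f' b"])
    then show ?thesis
      using field_differentiable_at_within field_differentiable_def by blast
  qed
  then show ?thesis by (simp add: holomorphic_on_def)
qed

text \<open>The interior \<open>E\<close> of the set where \<open>h = c\<close> is relatively closed in \<open>D\<close>: if a ball in \<open>D\<close>
  contains a point \<open>q\<close> of \<open>E\<close>, then every \<open>x\<close> in the ball is joined to \<open>q\<close> by a complex line
  that meets the ball in a convex planar set, and the one-variable identity theorem on that
  slice gives \<open>h x = c\<close>.\<close>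

lemma identity_theorem_along_lines:
  fixes h :: "complex ^ 'n \<Rightarrow> complex"
  assumes D: "open D" "connected D"
    and hol: "\<And>a b S. open S \<Longrightarrow> (\<And>\<zeta>. \<zeta> \<in> S \<Longrightarrow> a + \<zeta> *s b \<in> D) \<Longrightarrow> (\<lambda>\<zeta>. h (a + \<zeta> *s b)) holomorphic_on S"
    and U: "open U" "U \<noteq> {}" "U \<subseteq> D" "\<And>z. z \<in> U \<Longrightarrow> h z = c"
    and z: "z \<in> D"
  shows "h z = c"
proof -
  define E where "E = interior {z \<in> D. h z = c}"
  have cong: "w \<in> E" if p: "ball p r \<subseteq> D" and q: "q \<in> E" "q \<in> ball p r" and w: "w \<in> ball p r" for p q w r
  proof -
    have "h x = c" if x: "x \<in> ball p r" for x
    proof -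
      \<comment> \<open>\<open>L\<close> parametrises the complex line through \<open>q\<close> and \<open>x\<close>, with \<open>L 0 = q\<close> and \<open>L 1 = x\<close>.\<close>
      define L where "L \<zeta> = q + \<zeta> *s (x - q)" for \<zeta> :: complex
      have contL: "continuous_on UNIV L" unfolding L_def by (intro continuous_intros)
      have lin: "linear (\<lambda>\<zeta>. \<zeta> *s (x - q))"
        by (rule linearI) (auto simp: vec_eq_iff algebra_simps)
      define S where "S = L -` ball p r"
      have S: "open S" unfolding S_def by (rule open_vimage[OF open_ball contL])
      have "S = (\<lambda>\<zeta>. \<zeta> *s (x - q)) -` ball (p - q) r"
        by (auto simp: S_def L_def dist_norm algebra_simps)
      then have "convex S" using convex_linear_vimage[OF lin, of "ball (p - q) r"] by simp
      then have "connected S" by (rule convex_connected)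
      have "open (L -` E)" by (rule open_vimage[OF _ contL]) (simp add: E_def)
      moreover have "L 0 = q" "L 1 = x" by (auto simp: L_def)
      then have "0 \<in> S \<inter> L -` E" using q by (simp add: S_def)
      then have "S \<inter> L -` E \<noteq> {}" by blast
      moreover have "(\<lambda>\<zeta>. h (L \<zeta>)) holomorphic_on S"
        unfolding L_def by (rule hol[OF S]) (use p in \<open>auto simp: S_def L_def\<close>)
      ultimately have "h (L 1) = c"
        using interior_subset[of "{z \<in> D. h z = c}"] q x S \<open>L 1 = x\<close>
        by (intro analytic_continuation_open[of "S \<inter> L -` E" S "\<lambda>\<zeta>. h (L \<zeta>)" "\<lambda>_. c" 1, OF _ S _ \<open>connected S\<close>])
          (auto simp: E_def S_def)
      then show ?thesis by (simp add: L_def)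
    qed
    then have "ball p r \<subseteq> E" unfolding E_def using p by (intro interior_maximal) auto
    then show ?thesis using w by blast
  qed
  have "U \<subseteq> E" unfolding E_def using U by (intro interior_maximal) auto
  have "D \<subseteq> E"
  proof (rule ccontr)
    assume "\<not> D \<subseteq> E"
    have "open (D \<inter> - E)"
      unfolding open_contains_ball
    proof
      fix p assume p: "p \<in> D \<inter> - E"
      then obtain r where r: "r > 0" "ball p r \<subseteq> D"
        using D(1) by (auto simp: open_contains_ball)
      have "ball p r \<inter> E = {}"
        using cong[OF r(2), of _ p] p r(1) by auto
      then show "\<exists>e>0. ball p e \<subseteq> D \<inter> - E" using r by blast
    qed
    then show False
      using connectedD[OF D(2), of E "D \<inter> - E"] \<open>\<not> D \<subseteq> E\<close> \<open>U \<subseteq> E\<close> U E_def by auto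
  qed
  then show ?thesis using z interior_subset E_def by blast
qed

section \<open>The mean value property on circular domains\<close>

text \<open>By Morera's theorem: Fubini moves the integral over \<open>t\<close> outside the integral along each
  edge of a triangle, and for fixed \<open>t\<close> the three edge integrals cancel by Cauchy's theorem.\<close>

lemma holomorphic_on_integral_param:
  fixes G :: "complex \<Rightarrow> real \<Rightarrow> complex"
  assumes S: "open S"
    and cont: "continuous_on (S \<times> {\<alpha>..\<beta>}) (\<lambda>(\<zeta>, t). G \<zeta> t)"
    and hol: "\<And>t. t \<in> {\<alpha>..\<beta>} \<Longrightarrow> (\<lambda>\<zeta>. G \<zeta> t) holomorphic_on S"
  shows "(\<lambda>\<zeta>. integral {\<alpha>..\<beta>} (G \<zeta>)) holomorphic_on S"
proof (rule analytic_imp_holomorphic, rule Morera_triangle)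
  show "continuous_on S (\<lambda>\<zeta>. integral {\<alpha>..\<beta>} (G \<zeta>))"
    using integral_continuous_on_param[of S \<alpha> \<beta> G] cont by simp
  show "open S" by fact
  fix a b c
  define J where "J p q t = contour_integral (linepath p q) (\<lambda>\<zeta>. G \<zeta> t)" for p q t
  have edge: "((\<lambda>t. J p q t) has_integral
      contour_integral (linepath p q) (\<lambda>\<zeta>. integral {\<alpha>..\<beta>} (G \<zeta>))) {\<alpha>..\<beta>}"
    if seg: "closed_segment p q \<subseteq> S" for p q
  proof -
    have lp: "linepath p q s \<in> S" if "s \<in> {0..1}" for s
      using seg that linepath_in_path by blast
    have J_eq: "J p q t = integral {0..1} (\<lambda>s. G (linepath p q s) t * (q - p))" for t
      by (simp add: J_def contour_integral_integral)
    have cont1: "continuous_on ({\<alpha>..\<beta>} \<times> {0..1}) (\<lambda>(t, s). G (linepath p q s) t * (q - p))"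
      unfolding split_beta
    proof (rule continuous_on_mult[OF _ continuous_on_const])
      have "continuous_on ({\<alpha>..\<beta>} \<times> {0..1}) (\<lambda>x. (linepath p q (snd x), fst x))"
        unfolding linepath_def by (intro continuous_intros)
      then show "continuous_on ({\<alpha>..\<beta>} \<times> {0..1}) (\<lambda>x. G (linepath p q (snd x)) (fst x))"
        using continuous_on_compose2[OF cont, of "{\<alpha>..\<beta>} \<times> {0..1}" "\<lambda>x. (linepath p q (snd x), fst x)"] lp
        by (simp add: image_subset_iff)
    qed
    have "continuous_on {\<alpha>..\<beta>} (J p q)"
      unfolding J_eq
      using integral_continuous_on_param[of "{\<alpha>..\<beta>}" 0 1 "\<lambda>t s. G (linepath p q s) t * (q - p)"] cont1
      by simp
    then have "(J p q has_integral integral {\<alpha>..\<beta>} (J p q)) {\<alpha>..\<beta>}"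
      by (intro integrable_integral integrable_continuous_real)
    moreover have "integral {\<alpha>..\<beta>} (J p q)
        = integral {0..1} (\<lambda>s. integral {\<alpha>..\<beta>} (\<lambda>t. G (linepath p q s) t * (q - p)))"
      unfolding J_eq
      using integral_swap_continuous[of \<alpha> 0 \<beta> 1 "\<lambda>t s. G (linepath p q s) t * (q - p)"] cont1
      by (simp add: cbox_Pair_eq)
    ultimately show ?thesis
      by (simp add: contour_integral_integral)
  qed
  show "convex hull {a, b, c} \<subseteq> S \<longrightarrow>
     contour_integral (linepath a b) (\<lambda>\<zeta>. integral {\<alpha>..\<beta>} (G \<zeta>)) +
     contour_integral (linepath b c) (\<lambda>\<zeta>. integral {\<alpha>..\<beta>} (G \<zeta>)) +
     contour_integral (linepath c a) (\<lambda>\<zeta>. integral {\<alpha>..\<beta>} (G \<zeta>)) = 0"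
  proof
    assume hull: "convex hull {a, b, c} \<subseteq> S"
    have seg: "closed_segment a b \<subseteq> S" "closed_segment b c \<subseteq> S" "closed_segment c a \<subseteq> S"
      by (rule order_trans[OF segments_subset_convex_hull(1) hull]
          order_trans[OF segments_subset_convex_hull(3) hull]
          order_trans[OF segments_subset_convex_hull(5) hull])+
    have "J a b t + J b c t + J c a t = 0" if "t \<in> {\<alpha>..\<beta>}" for t
    proof -
      have "(\<lambda>\<zeta>. G \<zeta> t) holomorphic_on convex hull {a, b, c}"
        using hol[OF that] hull by (rule holomorphic_on_subset)
      then show ?thesis
        unfolding J_def
        by (intro has_chain_integral_chain_integral3 Cauchy_theorem_triangle)
    qed
    then have "((\<lambda>t. J a b t + J b c t + J c a t) has_integral 0) {\<alpha>..\<beta>}"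
      by (rule has_integral_is_0)
    then show "contour_integral (linepath a b) (\<lambda>\<zeta>. integral {\<alpha>..\<beta>} (G \<zeta>)) +
     contour_integral (linepath b c) (\<lambda>\<zeta>. integral {\<alpha>..\<beta>} (G \<zeta>)) +
     contour_integral (linepath c a) (\<lambda>\<zeta>. integral {\<alpha>..\<beta>} (G \<zeta>)) = 0"
      using has_integral_add[OF has_integral_add[OF edge[OF seg(1)] edge[OF seg(2)]] edge[OF seg(3)]]
      by (rule has_integral_unique[symmetric])
  qed
qed

lemma circular_rotate_iff:
  assumes "circular D"
  shows "cis t *s z \<in> D \<longleftrightarrow> z \<in> D"
proof -
  have rot: "cis t *s z \<in> D" if "z \<in> D" for t z
    using assms that unfolding circular_def cis_conv_exp by blast
  have "cis (-t) *s (cis t *s z) = z"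
    by (simp add: vector_smult_assoc cis_mult)
  then show ?thesis using rot[of z t] rot[of "cis t *s z" "-t"] by auto
qed

lemma circle_mean_holomorphic_along_line:
  fixes f :: "complex ^ 'n \<Rightarrow> complex"
  assumes D: "circular D" and f: "holomorphic_Cn f D"
    and S: "open S" "\<And>\<zeta>. \<zeta> \<in> S \<Longrightarrow> a + \<zeta> *s b \<in> D"
  shows "(\<lambda>\<zeta>. integral {\<alpha>..\<beta>} (\<lambda>t. f (cis t *s (a + \<zeta> *s b)))) holomorphic_on S"
proof (rule holomorphic_on_integral_param[OF S(1)])
  have "(\<lambda>x. cis (snd x) *s (a + fst x *s b)) ` (S \<times> {\<alpha>..\<beta>}) \<subseteq> D"
    using S(2) by (auto simp only: circular_rotate_iff[OF D] fst_conv)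
  then show "continuous_on (S \<times> {\<alpha>..\<beta>}) (\<lambda>(\<zeta>, t). f (cis t *s (a + \<zeta> *s b)))"
    unfolding split_beta
    by (intro continuous_on_compose2[OF holomorphic_Cn_continuous_on[OF f]] continuous_intros)
next
  fix t
  have eq: "cis t *s (a + \<zeta> *s b) = cis t *s a + \<zeta> *s (cis t *s b)" for \<zeta>
    by (simp add: vec_eq_iff algebra_simps)
  show "(\<lambda>\<zeta>. f (cis t *s (a + \<zeta> *s b))) holomorphic_on S"
    unfolding eq
    by (rule holomorphic_Cn_along_line[OF f])
       (simp only: eq[symmetric] circular_rotate_iff[OF D] S(2))
qed

text \<open>Within a ball around \<open>0\<close> the whole disc \<open>{\<zeta> z | \<bar>\<zeta>\<bar> \<le> 1}\<close> lies in \<open>D\<close>, so Cauchy's formula at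
  the centre of that disc applies.\<close>

lemma circle_mean_eq_centre_near_0:
  fixes f :: "complex ^ 'n \<Rightarrow> complex"
  assumes f: "holomorphic_Cn f D" and r: "ball 0 r \<subseteq> D" and z: "z \<in> ball 0 r"
  shows "integral {0..2 * pi} (\<lambda>t. f (cis t *s z)) = 2 * pi * f 0"
proof -
  have norm_scale: "norm (\<zeta> *s z) = norm \<zeta> * norm z" for \<zeta>
    by (simp add: norm_vec_def L2_set_def norm_mult power_mult_distrib sum_distrib_left[symmetric] real_sqrt_mult)
  have "(\<lambda>\<zeta>. f (0 + \<zeta> *s z)) holomorphic_on cball 0 1"
  proof (rule holomorphic_Cn_along_line[OF f])
    fix \<zeta> :: complex assume "\<zeta> \<in> cball 0 1"
    then have "norm (\<zeta> *s z) \<le> norm z" by (simp add: norm_scale mult_left_le_one_le)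
    then show "0 + \<zeta> *s z \<in> D" using z r by auto
  qed
  then have "((\<lambda>u. f (u *s z) / u) has_contour_integral (2 * of_real pi * \<i> * f 0)) (circlepath 0 1)"
    using Cauchy_integral_circlepath_simple[of "\<lambda>\<zeta>. f (\<zeta> *s z)" 0 1 0] by simp
  then have "contour_integral (circlepath 0 1) (\<lambda>u. f (u *s z) / u) = 2 * of_real pi * \<i> * f 0"
    by (rule contour_integral_unique)
  moreover have "contour_integral (circlepath 0 1) (\<lambda>u. f (u *s z) / u)
      = integral {0..2 * pi} (\<lambda>t. \<i> * f (cis t *s z))"
    unfolding circlepath_def by (subst contour_integral_part_circlepath_eq) (auto simp: mult.commute)
  ultimately show ?thesis by simp
qed

lemma circle_mean_eq_centre:
  fixes f :: "complex ^ 'n \<Rightarrow> complex"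
  assumes D: "domain_Cn D" "circular D" "0 \<in> D" and f: "holomorphic_Cn f D" and z: "z \<in> D"
  shows "integral {0..2 * pi} (\<lambda>t. f (cis t *s z)) = 2 * pi * f 0"
proof -
  have "open D" "connected D" using D(1) by (auto simp: domain_Cn_def)
  then obtain r where r: "r > 0" "ball 0 r \<subseteq> D" using D(3) by (auto simp: open_contains_ball)
  show ?thesis
  proof (rule identity_theorem_along_lines[OF \<open>open D\<close> \<open>connected D\<close>, where U = "ball 0 r"])
    show "ball (0 :: complex ^ 'n) r \<noteq> {}" using r by simp
    show "ball 0 r \<subseteq> D" "z \<in> D" by fact+
  qed (fact open_ball circle_mean_eq_centre_near_0[OF f r(2)]
         circle_mean_holomorphic_along_line[OF D(2) f])+
qed

lemma orthogonal_transformation_rotate: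
  "orthogonal_transformation (\<lambda>z :: complex ^ 'n. cis t *s z)"
  unfolding orthogonal_transformation
proof (intro conjI allI)
  show "linear (\<lambda>z :: complex ^ 'n. cis t *s z)"
    by (rule linearI) (auto simp: vec_eq_iff algebra_simps)
  show "norm (cis t *s z) = norm z" for z :: "complex ^ 'n"
    by (simp add: norm_vec_def norm_mult)
qed

text \<open>The integral of \<open>f(e\<^sup>i\<^sup>t z)\<close> over \<open>t \<in> [0, 2\<pi>]\<close> and all \<open>z\<close> is evaluated twice: integrating
  over \<open>z\<close> first, rotation invariance gives \<open>2\<pi> \<integral>f\<close>; integrating over \<open>t\<close> first, the circle mean
  gives \<open>2\<pi> f(0)\<close> for \<open>z\<close> in \<open>D\<close> and \<open>0\<close> elsewhere.\<close>

lemma mean_value_circular_domain: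
  fixes f :: "complex ^ 'n \<Rightarrow> complex"
  assumes D: "domain_Cn D" "circular D" "0 \<in> D"
    and f: "holomorphic_Cn f D" "\<And>z. z \<notin> D \<Longrightarrow> f z = 0" and int: "integrable lborel f"
  shows "integral\<^sup>L lborel f = f 0 * measure lborel D"
proof -
  have [measurable]: "f \<in> borel_measurable borel" using int by (auto dest: borel_measurable_integrable)
  define T where "T = {0..2 * pi}"
  define g where "g = (\<lambda>(t, z). indicator T t *\<^sub>R f (cis t *s z))"
  have [measurable]: "T \<in> sets borel" by (simp add: T_def)
  have rot [measurable]: "(\<lambda>z :: complex ^ 'n. cis t *s z) \<in> borel_measurable borel" for t
    by (intro borel_measurable_continuous_onI continuous_intros)
  have rot2: "(\<lambda>(t, z :: complex ^ 'n). cis t *s z) \<in> borel_measurable (borel \<Otimes>\<^sub>M borel)"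
    unfolding borel_prod split_beta by (intro borel_measurable_continuous_onI continuous_intros)
  have g_meas: "g \<in> borel_measurable (lborel \<Otimes>\<^sub>M lborel)"
    unfolding g_def using rot2 by (simp add: split_beta)
  have int_rot: "integrable lborel (\<lambda>z. h (cis t *s z))"
      and eq_rot: "(\<integral>z. h (cis t *s z) \<partial>lborel) = integral\<^sup>L lborel h"
    if "integrable lborel h" for h :: "complex ^ 'n \<Rightarrow> 'b::{banach,second_countable_topology}" and t
  proof -
    have [measurable]: "h \<in> borel_measurable borel" using that by (auto dest: borel_measurable_integrable)
    have "distr lborel borel (\<lambda>z :: complex ^ 'n. cis t *s z) = lborel"
      by (rule distr_lborel_orthogonal_transformation[OF orthogonal_transformation_rotate])
    then show "integrable lborel (\<lambda>z. h (cis t *s z))"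
      and "(\<integral>z. h (cis t *s z) \<partial>lborel) = integral\<^sup>L lborel h"
      using integrable_distr_eq[of "\<lambda>z. cis t *s z" lborel borel h]
        integral_distr[of "\<lambda>z. cis t *s z" lborel borel h] that by simp_all
  qed
  have "integrable (lborel \<Otimes>\<^sub>M lborel) g"
  proof (rule lborel_pair.Fubini_integrable[OF g_meas])
    have "(\<integral>z. norm (g (t, z)) \<partial>lborel) = indicator T t *\<^sub>R (\<integral>z. norm (f z) \<partial>lborel)" for t
      using eq_rot[OF integrable_norm[OF int], of t] by (simp add: g_def)
    moreover have "integrable lborel (\<lambda>t. indicator T t *\<^sub>R (\<integral>z. norm (f z) \<partial>lborel))"
      unfolding T_def by (rule borel_integrable_compact) auto
    ultimately show "integrable lborel (\<lambda>t. \<integral>z. norm (g (t, z)) \<partial>lborel)"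
      by simp
    show "AE t in lborel. integrable lborel (\<lambda>z. g (t, z))"
      using int_rot[OF int] by (auto simp: g_def)
  qed
  then have "integrable (lborel \<Otimes>\<^sub>M lborel) (\<lambda>(t, z). g (t, z))"
    by simp
  then have "(\<integral>z. (\<integral>t. g (t, z) \<partial>lborel) \<partial>lborel) = (\<integral>t. (\<integral>z. g (t, z) \<partial>lborel) \<partial>lborel)"
    by (rule lborel_pair.Fubini_integral)
  also have "\<dots> = (\<integral>t. indicator T t *\<^sub>R integral\<^sup>L lborel f \<partial>lborel)"
    using eq_rot[OF int] by (simp add: g_def)
  also have "\<dots> = 2 * pi * integral\<^sup>L lborel f"
    by (simp add: T_def scaleR_conv_of_real)
  finally have by_angle: "(\<integral>z. (\<integral>t. g (t, z) \<partial>lborel) \<partial>lborel) = 2 * pi * integral\<^sup>L lborel f" .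
  have on_circle: "(\<integral>t. g (t, z) \<partial>lborel) = 2 * pi * f 0 * indicator D z" for z
  proof (cases "z \<in> D")
    case True
    have "continuous_on {0..2 * pi} (\<lambda>t. f (cis t *s z))"
      by (intro continuous_on_compose2[OF holomorphic_Cn_continuous_on[OF f(1)]] continuous_intros)
         (auto simp: circular_rotate_iff[OF D(2)] True)
    then have "set_integrable lborel {0..2 * pi} (\<lambda>t. f (cis t *s z))"
      unfolding set_integrable_def by (intro borel_integrable_compact) auto
    then have "(\<integral>t. g (t, z) \<partial>lborel) = integral {0..2 * pi} (\<lambda>t. f (cis t *s z))"
      using set_borel_integral_eq_integral(2) by (simp add: g_def T_def set_lebesgue_integral_def)
    then show ?thesis using circle_mean_eq_centre[OF D f(1) True] True by simp
  next
    case False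
    then show ?thesis by (simp add: g_def f(2) circular_rotate_iff[OF D(2)])
  qed
  have "(\<integral>z. 2 * pi * f 0 * indicator D z \<partial>lborel) = 2 * pi * f 0 * measure lborel D"
  proof -
    have "(indicator D :: complex ^ 'n \<Rightarrow> complex) = (\<lambda>z. of_real (indicator D z))"
      by (simp add: fun_eq_iff indicator_def)
    moreover have "(\<integral>z. indicator D z \<partial>lborel) = measure lborel D"
      by simp
    ultimately have "(\<integral>z. indicator D z \<partial>lborel) = complex_of_real (measure lborel D)"
      by (simp only: integral_complex_of_real)
    then show ?thesis by simp
  qed
  then show ?thesis
    using by_angle unfolding on_circle by auto
qed

section \<open>The Bergman space and its projection\<close>

lemma holomorphic_Cn_diff:
  assumes "holomorphic_Cn f D" "holomorphic_Cn g D"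
  shows "holomorphic_Cn (\<lambda>z. f z - g z) D"
  unfolding holomorphic_Cn_def
proof
  fix z assume "z \<in> D"
  then obtain f' g' where "(f has_derivative f') (at z)" "\<And>c v. f' (c *s v) = c * f' v"
      "(g has_derivative g') (at z)" "\<And>c v. g' (c *s v) = c * g' v"
    using assms unfolding holomorphic_Cn_def by meson
  then show "\<exists>h'. ((\<lambda>z. f z - g z) has_derivative h') (at z) \<and> (\<forall>c v. h' (c *s v) = c * h' v)"
    by (intro exI[of _ "\<lambda>v. f' v - g' v"]) (auto intro!: derivative_eq_intros simp: algebra_simps)
qed

lemma holomorphic_Cn_mult:
  assumes "holomorphic_Cn f D" "holomorphic_Cn g D"
  shows "holomorphic_Cn (\<lambda>z. f z * g z) D"
  unfolding holomorphic_Cn_def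
proof
  fix z assume "z \<in> D"
  then obtain f' g' where "(f has_derivative f') (at z)" "\<And>c v. f' (c *s v) = c * f' v"
      "(g has_derivative g') (at z)" "\<And>c v. g' (c *s v) = c * g' v"
    using assms unfolding holomorphic_Cn_def by meson
  then show "\<exists>h'. ((\<lambda>z. f z * g z) has_derivative h') (at z) \<and> (\<forall>c v. h' (c *s v) = c * h' v)"
    by (intro exI[of _ "\<lambda>v. f z * g' v + f' v * g z"]) (auto intro!: derivative_eq_intros simp: algebra_simps)
qed

lemma bergman_space_borel_measurable:
  assumes "open D" "f \<in> bergman_space D"
  shows "f \<in> borel_measurable borel"
proof -
  have "(\<lambda>z. indicator D z *\<^sub>R f z) \<in> borel_measurable borel"
    using assms by (intro borel_measurable_continuous_on_indicator holomorphic_Cn_continuous_on)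
      (auto simp: bergman_space_def)
  moreover have "(\<lambda>z. indicator D z *\<^sub>R f z) = f"
    using assms by (auto simp: bergman_space_def fun_eq_iff indicator_def)
  ultimately show ?thesis by simp
qed

lemma borel_measurable_cnj [measurable]: "cnj \<in> borel_measurable borel"
  by (intro borel_measurable_continuous_onI continuous_intros)

lemma L2_on_mult_cnj_integrable:
  assumes "f \<in> L2_on D" "g \<in> L2_on D"
  shows "integrable (lebesgue_on D) (\<lambda>z. f z * cnj (g z))"
proof (rule Bochner_Integration.integrable_bound)
  show "integrable (lebesgue_on D) (\<lambda>z. (cmod (f z))\<^sup>2 + (cmod (g z))\<^sup>2)"
    using assms by (auto simp: L2_on_def)
  have [measurable]: "f \<in> borel_measurable (lebesgue_on D)" "g \<in> borel_measurable (lebesgue_on D)"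
    using assms by (auto simp: L2_on_def)
  show "(\<lambda>z. f z * cnj (g z)) \<in> borel_measurable (lebesgue_on D)" by measurable
  show "AE z in lebesgue_on D. norm (f z * cnj (g z)) \<le> norm ((cmod (f z))\<^sup>2 + (cmod (g z))\<^sup>2)"
  proof (rule AE_I2)
    fix z
    have "0 \<le> (cmod (f z) - cmod (g z))\<^sup>2" "0 \<le> cmod (f z) * cmod (g z)" by auto
    then show "norm (f z * cnj (g z)) \<le> norm ((cmod (f z))\<^sup>2 + (cmod (g z))\<^sup>2)"
      unfolding norm_mult complex_mod_cnj real_norm_def power2_diff by linarith
  qed
qed

lemma L2_on_cnj: "f \<in> L2_on D \<Longrightarrow> (\<lambda>z. cnj (f z)) \<in> L2_on D"
  by (auto simp: L2_on_def intro: measurable_compose[OF _ borel_measurable_cnj])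

lemma L2_on_diff:
  assumes "f \<in> L2_on D" "g \<in> L2_on D" shows "(\<lambda>z. f z - g z) \<in> L2_on D"
proof -
  have [measurable]: "f \<in> borel_measurable (lebesgue_on D)" "g \<in> borel_measurable (lebesgue_on D)"
    using assms by (auto simp: L2_on_def)
  have "integrable (lebesgue_on D) (\<lambda>z. (cmod (f z - g z))\<^sup>2)"
  proof (rule Bochner_Integration.integrable_bound)
    show "integrable (lebesgue_on D) (\<lambda>z. 2 * (cmod (f z))\<^sup>2 + 2 * (cmod (g z))\<^sup>2)"
      using assms by (auto simp: L2_on_def)
    show "AE z in lebesgue_on D. norm ((cmod (f z - g z))\<^sup>2) \<le> norm (2 * (cmod (f z))\<^sup>2 + 2 * (cmod (g z))\<^sup>2)"
    proof (rule AE_I2)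
      fix z
      have "(cmod (f z - g z))\<^sup>2 \<le> (cmod (f z) + cmod (g z))\<^sup>2"
        by (intro power_mono norm_triangle_ineq4) auto
      also have "\<dots> \<le> 2 * (cmod (f z))\<^sup>2 + 2 * (cmod (g z))\<^sup>2"
        using sum_squares_bound[of "cmod (f z)" "cmod (g z)"] by (simp add: power2_sum)
      finally show "norm ((cmod (f z - g z))\<^sup>2) \<le> norm (2 * (cmod (f z))\<^sup>2 + 2 * (cmod (g z))\<^sup>2)"
        by simp
    qed
  qed measurable
  then show ?thesis by (simp add: L2_on_def)
qed

lemma indicator_in_bergman_space:
  assumes D: "open D" "bounded D"
  shows "(\<lambda>z. c * indicator D z) \<in> bergman_space D"
proof -
  have "((\<lambda>z. c * indicator D z :: complex) has_derivative (\<lambda>_. 0)) (at z)" if "z \<in> D" for z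
    by (rule has_derivative_transform_within_open[of "\<lambda>_. c" _ _ _ D]) (use D that in auto)
  then have "holomorphic_Cn (\<lambda>z. c * indicator D z) D"
    unfolding holomorphic_Cn_def by (auto intro!: exI[of _ "\<lambda>_. 0"])
  moreover have "integrable (lebesgue_on D) (\<lambda>z. (cmod (c * indicator D z))\<^sup>2)"
  proof -
    have "D \<in> lmeasurable" using D by (intro bounded_set_imp_lmeasurable) auto
    then have "integrable (lebesgue_on D) (\<lambda>z. (cmod c)\<^sup>2)"
      by (intro finite_measure.integrable_const finite_measure_lebesgue_on)
    then show ?thesis
      by (rule Bochner_Integration.integrable_cong[THEN iffD1, rotated -1]) auto
  qed
  moreover have "(\<lambda>z. c * indicator D z) \<in> borel_measurable (lebesgue_on D)"
  proof (rule measurable_restrict_space1)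
    have [measurable]: "D \<in> sets lebesgue" using D(1) by simp
    show "(\<lambda>z. c * indicator D z) \<in> borel_measurable lebesgue" by measurable
  qed
  ultimately show ?thesis by (simp add: bergman_space_def L2_on_def)
qed

lemma bergman_space_diff:
  "f \<in> bergman_space D \<Longrightarrow> g \<in> bergman_space D \<Longrightarrow> (\<lambda>z. f z - g z) \<in> bergman_space D"
  by (auto simp: bergman_space_def L2_on_diff holomorphic_Cn_diff)

text \<open>A function of norm zero vanishes almost everywhere; the set where a continuous function is
  nonzero is open, and a negligible open set is empty.\<close>

lemma bergman_space_eq_0:
  assumes D: "open D" and f: "f \<in> bergman_space D" and zero: "L2_inner D f f = 0"
  shows "f z = 0"
proof (rule ccontr)
  assume nz: "f z \<noteq> 0"
  then have z: "z \<in> D" using f by (auto simp: bergman_space_def)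
  have cont: "continuous_on D f"
    using f by (auto simp: bergman_space_def intro: holomorphic_Cn_continuous_on)
  have L2: "f \<in> L2_on D" using f by (auto simp: bergman_space_def)
  have int: "integrable (lebesgue_on D) (\<lambda>z. (cmod (f z))\<^sup>2)"
    using L2 by (auto simp: L2_on_def)
  have "L2_inner D f f = of_real (\<integral>z. (cmod (f z))\<^sup>2 \<partial>lebesgue_on D)"
    unfolding L2_inner_def by (simp add: complex_norm_square[symmetric] flip: integral_complex_of_real)
  then have "AE z in lebesgue_on D. (cmod (f z))\<^sup>2 = 0"
    using zero integral_nonneg_eq_0_iff_AE[OF int] by simp
  then have "AE z in lebesgue. z \<in> D \<longrightarrow> f z = 0"
    using D by (subst (asm) AE_restrict_space_iff) auto
  moreover have op: "open {z \<in> D. f z \<noteq> 0}"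
    using continuous_open_preimage[OF cont D, of "- {0}"] by (simp add: vimage_def Int_def open_Compl)
  ultimately have "negligible {z \<in> D. f z \<noteq> 0}"
    by (subst negligible_iff_null_sets, subst AE_iff_null_sets) auto
  then show False using op open_not_negligible nz z by blast
qed

text \<open>Two elements of the Bergman space with this orthogonality property differ by an element
  orthogonal to itself, so the definite description is determined by any one witness.\<close>

lemma bergman_projection_eqI:
  assumes D: "open D" and f: "f \<in> L2_on D" and g: "g \<in> bergman_space D"
    and orth: "\<And>h. h \<in> bergman_space D \<Longrightarrow> L2_inner D (\<lambda>z. f z - g z) h = 0"
  shows "bergman_projection D f = g"
  unfolding bergman_projection_def
proof (rule the_equality)
  show "g \<in> bergman_space D \<and> (\<forall>h\<in>bergman_space D. L2_inner D (\<lambda>z. f z - g z) h = 0)"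
    using g orth by blast
  fix k assume k: "k \<in> bergman_space D \<and> (\<forall>h\<in>bergman_space D. L2_inner D (\<lambda>z. f z - k z) h = 0)"
  define d where "d = (\<lambda>z. k z - g z)"
  have d: "d \<in> bergman_space D" unfolding d_def using k g by (auto intro: bergman_space_diff)
  have L2: "k \<in> L2_on D" "g \<in> L2_on D" "d \<in> L2_on D" using k g d by (auto simp: bergman_space_def)
  have "L2_inner D d d = L2_inner D (\<lambda>z. f z - g z) d - L2_inner D (\<lambda>z. f z - k z) d"
    unfolding L2_inner_def
    by (subst Bochner_Integration.integral_diff[symmetric])
      (intro L2_on_mult_cnj_integrable L2_on_diff f L2 | simp add: d_def algebra_simps)+
  also have "\<dots> = 0" using k orth d by simp
  finally have "d z = 0" for z by (rule bergman_space_eq_0[OF D d])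
  then show "k = g" by (auto simp: d_def fun_eq_iff)
qed

text \<open>The functions \<open>g h\<close> and \<open>g(0) h\<close> agree at \<open>0\<close>, so by the mean value property they have the
  same integral over \<open>D\<close>.\<close>

lemma friedrichs_operator_circular_domain:
  fixes D :: "(complex ^ 'n) set"
  assumes D: "domain_Cn D" "bounded D" "circular D" "0 \<in> D" and g: "g \<in> bergman_space D"
  shows "friedrichs_operator D g = (\<lambda>z. cnj (g 0) * indicator D z)"
  unfolding friedrichs_operator_def
proof (rule bergman_projection_eqI)
  show "open D" using D by (simp add: domain_Cn_def)
  let ?e = "\<lambda>z. cnj (g 0) * indicator D z"
  have L2: "f \<in> L2_on D" if "f \<in> bergman_space D" for f using that by (simp add: bergman_space_def)
  show "(\<lambda>z. cnj (g z)) \<in> L2_on D" by (intro L2_on_cnj L2 g)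
  show "?e \<in> bergman_space D" by (rule indicator_in_bergman_space) fact+
  fix h assume h: "h \<in> bergman_space D"
  have mean: "(\<integral>z. f z * h z \<partial>lebesgue_on D) = f 0 * h 0 * measure lborel D"
    if f: "f \<in> bergman_space D" for f
  proof -
    have meas: "(\<lambda>z. f z * h z) \<in> borel_measurable borel"
      using bergman_space_borel_measurable[OF \<open>open D\<close>] f h by measurable
    have ind: "(\<lambda>z. indicator D z *\<^sub>R (f z * h z)) = (\<lambda>z. f z * h z)"
      using f by (auto simp: bergman_space_def indicator_def fun_eq_iff)
    have "integrable (lebesgue_on D) (\<lambda>z. f z * h z)"
      using L2_on_mult_cnj_integrable[OF L2[OF f] L2_on_cnj[OF L2[OF h]]] by simp
    then have "integrable lebesgue (\<lambda>z. f z * h z)"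
      using \<open>open D\<close> by (subst (asm) integrable_restrict_space) (auto simp: ind)
    then have int: "integrable lborel (\<lambda>z. f z * h z)"
      using meas by (subst (asm) integrable_completion) auto
    have "(\<integral>z. f z * h z \<partial>lebesgue_on D) = (\<integral>z. f z * h z \<partial>lebesgue)"
      using \<open>open D\<close> by (subst integral_restrict_space) (auto simp: ind)
    also have "\<dots> = (\<integral>z. f z * h z \<partial>lborel)"
      using meas by (intro integral_completion) auto
    also have "\<dots> = f 0 * h 0 * measure lborel D"
      using f h by (intro mean_value_circular_domain D int holomorphic_Cn_mult)
        (auto simp: bergman_space_def)
    finally show ?thesis .
  qed
  have "L2_inner D (\<lambda>z. cnj (g z) - ?e z) h
      = cnj (\<integral>z. g z * h z - (g 0 * indicator D z) * h z \<partial>lebesgue_on D)"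
    unfolding L2_inner_def Bochner_Integration.integral_cnj[symmetric]
    by (rule Bochner_Integration.integral_cong) (auto simp: algebra_simps indicator_def)
  also have "(\<integral>z. g z * h z - (g 0 * indicator D z) * h z \<partial>lebesgue_on D) =
     (\<integral>z. g z * h z \<partial>lebesgue_on D) - (\<integral>z. (g 0 * indicator D z) * h z \<partial>lebesgue_on D)"
    using L2_on_mult_cnj_integrable[OF L2 L2_on_cnj[OF L2[OF h]]] g
      indicator_in_bergman_space[OF \<open>open D\<close> D(2)]
    by (intro Bochner_Integration.integral_diff) auto
  also have "\<dots> = 0"
    using mean[OF g] mean[OF indicator_in_bergman_space[OF \<open>open D\<close> D(2), of "g 0"]] D(4) by simp
  finally show "L2_inner D (\<lambda>z. cnj (g z) - ?e z) h = 0" by simp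
qed

theorem proposition2p2:
  fixes D :: "(complex ^ 'n) set"
  assumes "domain_Cn D"
    and "bounded D"
    and "circular D"
    and "0 \<in> D"
  shows "rank_one_on (bergman_space D) (friedrichs_operator D)"
proof -
  let ?e = "indicator D :: complex ^ 'n \<Rightarrow> complex"
  have "open D" using assms(1) by (simp add: domain_Cn_def)
  have "friedrichs_operator D ` bergman_space D = range (\<lambda>c. fun_scale c ?e)"
  proof (intro equalityI subsetI)
    fix u assume "u \<in> range (\<lambda>c. fun_scale c ?e)"
    then obtain c where c: "u = fun_scale c ?e" by blast
    have "(\<lambda>z. cnj c * ?e z) \<in> bergman_space D"
      by (rule indicator_in_bergman_space) fact+
    moreover from this have "friedrichs_operator D (\<lambda>z. cnj c * ?e z) = u"
      using assms(4) by (simp add: friedrichs_operator_circular_domain[OF assms] c fun_scale_def)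
    ultimately show "u \<in> friedrichs_operator D ` bergman_space D" by blast
  qed (auto simp: friedrichs_operator_circular_domain[OF assms] fun_scale_def)
  also have "\<dots> = cfun.span {?e}"
    by (simp add: cfun.span_singleton)
  finally have range: "friedrichs_operator D ` bergman_space D = cfun.span {?e}" .
  have "?e 0 \<noteq> 0" using assms(4) by simp
  then have "?e \<noteq> 0" by (metis zero_fun_apply)
  then have "cfun.dim {?e} = 1"
    by (subst cfun.dim_eq_card_independent) simp_all
  then show ?thesis
    unfolding rank_one_on_def range by (simp add: cfun.subspace_span)
qed

end
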